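(* Let $d\in\mathbb N$, let $q$ be a prime power, and suppose that $p(x)\in\mathbb F_q[x]$ is a primitive polynomial of degree $d-1$ with no zero coefficients. Then there is a pure simplicial complex $C$ of dimension $d-1$ with $n=(d+2)q$ vertices and at least $\frac{n^{d-1}}{(d+2)^{d-1}}-1$ facets whose dual graph $G(C)$ is a cycle.
   Context: A pure simplicial complex of dimension $d-1$ on a vertex set $V$ is a family $C$ of $d$-element subsets of $V$, called facets; it has $n$ vertices when $|V|=n$. The dual graph $G(C)$ has the facets as vertices, two facets $X,Y$ being adjacent iff $|X\cap Y|=d-1$. A primitive polynomial of degree $m$ over $\mathbb F_q$ is a monic polynomial of degree $m$ in $\mathbb F_q[x]$ that is the minimal polynomial of a primitive element (generator of the multiplicative group) of $\mathbb F_{q^m}$. *)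

theory Defs
  imports
    "HOL-Algebra.Algebraic_Closure_Type"
    "HOL-Number_Theory.Prime_Powers"
    "HOL-Library.Cardinality"
begin

text \<open>
  A complex of dimension \<open>d - 1\<close> is given by its set of facets, and it is indexed here by the
  facet size \<open>d\<close>. Not every element of \<open>V\<close> has to lie in a facet.
\<close>

definition pure_complex :: "nat \<Rightarrow> 'v set \<Rightarrow> 'v set set \<Rightarrow> bool" where
  "pure_complex d V C \<longleftrightarrow> finite V \<and> (\<forall>F\<in>C. F \<subseteq> V \<and> card F = d)"

definition dual_edges :: "nat \<Rightarrow> 'v set set \<Rightarrow> 'v set set set" where
  "dual_edges d C = {{F, G} | F G. F \<in> C \<and> G \<in> C \<and> F \<noteq> G \<and> card (F \<inter> G) = d - 1}"

text \<open>A simple graph is given by its vertices and its edges, which are two-element sets.\<close>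

definition is_cycle_graph :: "'a set \<Rightarrow> 'a set set \<Rightarrow> bool" where
  "is_cycle_graph V E \<longleftrightarrow>
     (\<exists>k::nat. k \<ge> 3 \<and> (\<exists>f. bij_betw f {..<k} V \<and> E = {{f i, f ((i + 1) mod k)} | i. i < k}))"

text \<open>
  All finite extensions of the base field are taken inside its algebraic closure, with the
  inclusion \<^const>\<open>to_ac\<close>; the subfield with \<open>q ^ m\<close> elements is then a model of the field with
  \<open>q ^ m\<close> elements.
\<close>

definition is_minimal_polynomial :: "'a::field alg_closure \<Rightarrow> 'a Polynomial.poly \<Rightarrow> bool" where
  "is_minimal_polynomial a p \<longleftrightarrow>
     lead_coeff p = 1 \<and> poly (map_poly to_ac p) a = 0 \<and>
     (\<forall>r. r \<noteq> 0 \<and> poly (map_poly to_ac r) a = 0 \<longrightarrow> Polynomial.degree p \<le> Polynomial.degree r)"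

definition primitive_element :: "'k::field set \<Rightarrow> 'k \<Rightarrow> bool" where
  "primitive_element K a \<longleftrightarrow> K - {0} = range (\<lambda>i::int. a powi i)"

definition primitive_polynomial :: "nat \<Rightarrow> 'a::finite_field Polynomial.poly \<Rightarrow> bool" where
  "primitive_polynomial m p \<longleftrightarrow>
     lead_coeff p = 1 \<and> Polynomial.degree p = m \<and>
     (\<exists>(K :: 'a alg_closure set) a.
        subfield K ring_of_type_algebra \<and> range to_ac \<subseteq> K \<and> card K = CARD('a) ^ m \<and>
        primitive_element K a \<and> is_minimal_polynomial a p)"

end

theory Submission
  imports Defs "HOL-Number_Theory.Cong"
begin

text \<open>
  Let \<open>u\<close> be a linear recurring sequence over \<open>\<F>\<^sub>q\<close> with characteristic polynomial
  \<open>p\<close>. Colour position \<open>i\<close> by \<open>i mod (d + 2)\<close>; the vertices are the pairs (colour, field element),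
  and the facets are the windows of \<open>d\<close> consecutive terms. Each window misses two cyclically
  consecutive colours. If two windows share \<open>d - 1\<close> vertices, their colour offset is \<open>0\<close> or
  \<open>\<plusminus>1\<close>. At offset \<open>0\<close> they coincide, because the recurrence has no zero coefficient and so any
  \<open>d - 1\<close> terms of a window determine the last one. At offset \<open>\<plusminus>1\<close> they share a full state of
  the recurrence, and since \<open>p\<close> is primitive a state occurs once per period, so the windows are
  consecutive.
\<close>

section \<open>Windows of a coloured periodic sequence\<close>

text \<open>Isolates what the combinatorics needs from the sequence: \<open>determined\<close> will
  come from the nonzero coefficients of the recurrence, \<open>state\<close> from primitivity
  together with the colours.\<close>

locale coloured_sequence =
  fixes d L :: nat and v :: "nat \<Rightarrow> 'v"
  assumes d_ge: "d \<ge> 2"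
    and L_pos: "L > 0"
    and dvd_L: "(d + 2) dvd L"
    and colour: "v i = v j \<Longrightarrow> i mod (d + 2) = j mod (d + 2)"
    and periodic: "v (i + L) = v i"
    and determined: "\<lbrakk>s < d; \<And>t. \<lbrakk>t < d; t \<noteq> s\<rbrakk> \<Longrightarrow> v (i + t) = v (j + t)\<rbrakk> \<Longrightarrow> v (i + s) = v (j + s)"
    and state: "(\<And>t. t < d - 1 \<Longrightarrow> v (i + t) = v (j + t)) \<Longrightarrow> i mod L = j mod L"
begin

definition window :: "nat \<Rightarrow> 'v set" where
  "window i = (\<lambda>t. v (i + t)) ` {..<d}"

lemma L_ge: "L \<ge> 4"
  using dvd_imp_le[OF dvd_L L_pos] d_ge by simp

lemma periodic_mult: "v (i + L * c) = v i"
proof (induction c)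
  case (Suc c)
  have "v (i + L * Suc c) = v ((i + L * c) + L)"
    by (simp add: algebra_simps)
  then show ?case
    using Suc periodic by simp
qed simp

lemma window_periodic_mult: "window (i + L * c) = window i"
proof -
  have "v (i + L * c + t) = v (i + t)" for t
    using periodic_mult[of "i + t" c] by (simp add: algebra_simps)
  then show ?thesis
    by (simp add: window_def)
qed

lemma window_mod: "window (i mod L) = window i"
  using window_periodic_mult[of "i mod L" "i div L"] by simp

text \<open>The \<open>d\<close> consecutive positions have distinct residues modulo
  \<open>d + 2\<close>, hence distinct colours.\<close>

lemma inj_on_window: "inj_on (\<lambda>t. v (i + t)) {..<d}"
proof (rule inj_onI)
  fix s t assume st: "s \<in> {..<d}" "t \<in> {..<d}" "v (i + s) = v (i + t)"
  then have "[i + s = i + t] (mod (d + 2))"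
    using colour[OF st(3)] by (simp add: cong_def)
  then have "[s = t] (mod (d + 2))"
    by (simp add: cong_add_lcancel_nat)
  then show "s = t"
    using st by (simp add: cong_def)
qed

lemma card_window: "card (window i) = d"
  using card_image[OF inj_on_window] by (simp add: window_def)

lemma finite_window: "finite (window i)"
  by (simp add: window_def)

section \<open>Relative position of two windows\<close>

text \<open>Adding \<open>L * i\<close>, a multiple of the period, lifts \<open>j\<close> to at
  least \<open>i\<close> without changing its window, so the offset is a natural number with
  remainder \<open>e\<close>.\<close>

lemma offset_exists:
  obtains e c where "e < d + 2" "j + L * i = i + e + (d + 2) * c"
proof -
  have "i \<le> j + L * i"
    using L_pos by (simp add: trans_le_add2)
  then have "j + L * i = i + (j + L * i - i) mod (d + 2) + (d + 2) * ((j + L * i - i) div (d + 2))"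
    by (simp only: add.assoc mod_mult_div_eq le_add_diff_inverse)
  then show ?thesis
    using that[of "(j + L * i - i) mod (d + 2)"] by simp
qed

text \<open>Equal vertices have equal colours, so \<open>t\<close> and \<open>e + t'\<close> agree
  modulo \<open>d + 2\<close>; since \<open>e + t'\<close> is below \<open>2 * (d + 2)\<close>, at
  most one wraparound occurs.\<close>

lemma shared_vertex_position:
  assumes "t < d" "e < d + 2" "j = i + e + (d + 2) * c" "v (i + t) \<in> window j"
  obtains t' where "t' < d" "v (i + t) = v (j + t')" "e + t' = t \<or> e + t' = t + (d + 2)"
proof -
  obtain t' where t': "t' < d" "v (i + t) = v (j + t')"
    using assms(4) by (auto simp: window_def)
  have "[i + t = i + (e + t' + (d + 2) * c)] (mod (d + 2))"
    using colour[OF t'(2)] assms(3) by (simp add: cong_def algebra_simps)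
  then have "[t = e + t' + (d + 2) * c] (mod (d + 2))"
    by (simp only: cong_add_lcancel_nat)
  then have *: "t = (e + t') mod (d + 2)"
    using assms(1) unfolding cong_def mod_mult_self2 by simp
  have "e + t' = t \<or> e + t' = t + (d + 2)"
  proof (cases "e + t' < d + 2")
    case False
    then have "(e + t') mod (d + 2) = e + t' - (d + 2)"
      using assms(2) t'(1) by (simp add: le_mod_geq)
    then show ?thesis
      using * False by linarith
  qed (use * in simp)
  then show ?thesis
    using that t' by blast
qed

text \<open>Counted from \<open>i\<close>, \<open>window j\<close> carries the colours of
  \<open>e, ..., e + d - 1\<close> modulo \<open>d + 2\<close>; the two it omits are those of
  \<open>e - 1\<close> and \<open>e - 2\<close>.\<close>

lemma missing_vertex:
  assumes "e < d + 2" "j = i + e + (d + 2) * c" "t < d" "t + 1 = e \<or> t + 2 = e"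
  shows "v (i + t) \<notin> window j"
proof
  assume "v (i + t) \<in> window j"
  then obtain t' where "t' < d" "e + t' = t \<or> e + t' = t + (d + 2)"
    using shared_vertex_position assms by metis
  then show False
    using assms(4) by linarith
qed

lemma window_eq_imp:
  assumes "window i = window j"
  shows "i mod L = j mod L"
proof -
  obtain e c where ec: "e < d + 2" "j + L * i = i + e + (d + 2) * c"
    by (rule offset_exists)
  have shared: "v (i + t) \<in> window (j + L * i)" if "t < d" for t
    using assms that window_periodic_mult unfolding window_def by blast
  have "e = 0"
  proof (rule ccontr)
    assume "e \<noteq> 0"
    \<comment> \<open>Position \<open>e - 1\<close> lies in the window unless
      \<open>e = d + 1\<close>, and then \<open>e - 2 = d - 1\<close> does.\<close>
    then have "e - 1 < d \<and> e - 1 + 1 = e \<or> e - 2 < d \<and> e - 2 + 2 = e"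
      using ec(1) d_ge by linarith
    then obtain t where "t < d" "t + 1 = e \<or> t + 2 = e"
      by blast
    then show False
      using missing_vertex[OF ec] shared by blast
  qed
  have "i mod L = (j + L * i) mod L"
  proof (rule state)
    fix t assume "t < d - 1"
    then have "t < d"
      by simp
    from shared_vertex_position[OF this ec shared[OF this]]
    obtain t' where "t' < d" "v (i + t) = v (j + L * i + t')" "e + t' = t \<or> e + t' = t + (d + 2)" .
    then show "v (i + t) = v (j + L * i + t)"
      using \<open>e = 0\<close> by auto
  qed
  then show ?thesis
    by simp
qed

lemma inj_on_windows: "inj_on window {..<L}"
proof (rule inj_onI)
  fix i j assume "i \<in> {..<L}" "j \<in> {..<L}" "window i = window j"
  then show "i = j"
    using window_eq_imp[of i j] by simp
qed

text \<open>Just one vertex of \<open>window i\<close>, at position \<open>s\<close>, is absent from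
  \<open>window j\<close>, whereas an offset from 2 to \<open>d\<close> would lose two. This leaves
  the cyclic offsets 0, 1 and -1.\<close>

lemma adjacent_windows_imp:
  assumes neq: "window i \<noteq> window j" and card: "card (window i \<inter> window j) = d - 1"
  shows "Suc i mod L = j mod L \<or> i mod L = Suc j mod L"
proof -
  obtain e c where ec: "e < d + 2" "j + L * i = i + e + (d + 2) * c"
    by (rule offset_exists)
  define j' where "j' = j + L * i"
  have ec': "j' = i + e + (d + 2) * c"
    using ec(2) by (simp add: j'_def)
  have j': "window j' = window j" "j' mod L = j mod L" "Suc j' mod L = Suc j mod L"
    using window_periodic_mult[of j i] mod_mult_self2[of "Suc j" L i] by (simp_all add: j'_def)
  have "card (window i - window j') = 1"
    using card j' card_window[of i] card_Diff_subset_Int[of "window i" "window j"]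
      finite_window d_ge by simp
  then obtain x where x: "window i - window j' = {x}"
    by (auto simp: card_1_singleton_iff)
  then obtain s where s: "s < d" "x = v (i + s)"
    by (auto simp: window_def)
  have unique: "t = s" if "t < d" "v (i + t) \<notin> window j'" for t
  proof -
    have "v (i + t) \<in> window i - window j'"
      using that by (auto simp: window_def)
    then have "v (i + t) = v (i + s)"
      using x s by blast
    then show ?thesis
      using inj_on_window[of i] that s by (auto dest: inj_onD)
  qed
  have shared: "\<exists>t'<d. v (i + t) = v (j' + t') \<and> (e + t' = t \<or> e + t' = t + (d + 2))"
    if "t < d" "t \<noteq> s" for t
    using unique[of t] that shared_vertex_position[OF that(1) ec(1) ec'] by metis
  have bad: "t = s" if "t < d" "t + 1 = e \<or> t + 2 = e" for t
    using missing_vertex[OF ec(1) ec' that] unique that by blast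
  consider "e = 0" | "e = 1" | "e = d + 1" | "2 \<le> e" "e \<le> d"
    using ec(1) by linarith
  then show ?thesis
  proof cases
    case 1
    \<comment> \<open>The other \<open>d - 1\<close> terms agree place by place and force agreement
      at \<open>s\<close> too, against the choice of \<open>s\<close>.\<close>
    have eq: "v (i + t) = v (j' + t)" if "t < d" "t \<noteq> s" for t
      using shared[OF that] 1 by auto
    have "v (i + s) = v (j' + s)"
      by (rule determined[OF s(1) eq])
    then have "v (i + s) \<in> window j'"
      using s by (auto simp: window_def)
    then show ?thesis
      using x s by blast
  next
    case 2
    \<comment> \<open>Offset 1 loses position 0, so the remaining \<open>d - 1\<close> terms of
      \<open>window i\<close> are the state at \<open>j'\<close>.\<close>
    then have "s = 0"
      using bad[of 0] d_ge by simp
    have "Suc i mod L = j' mod L"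
    proof (rule state)
      fix t assume "t < d - 1"
      then have "Suc t < d" "Suc t \<noteq> s"
        using \<open>s = 0\<close> by simp_all
      then obtain t' where t': "t' < d" "v (i + Suc t) = v (j' + t')"
          "e + t' = Suc t \<or> e + t' = Suc t + (d + 2)"
        using shared by blast
      then have "t' = t"
        using 2 by auto
      then show "v (Suc i + t) = v (j' + t)"
        using t' by simp
    qed
    then show ?thesis
      using j' by simp
  next
    case 3
    \<comment> \<open>Offset \<open>d + 1\<close> is -1 modulo \<open>d + 2\<close>: the last
      position is lost, and the first \<open>d - 1\<close> terms are the state at
      \<open>Suc j'\<close>.\<close>
    then have "s = d - 1"
      using bad[of "d - 1"] d_ge by simp
    have "i mod L = Suc j' mod L"
    proof (rule state)
      fix t assume t: "t < d - 1"
      then have "t < d" "t \<noteq> s"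
        using \<open>s = d - 1\<close> by simp_all
      then obtain t' where t': "t' < d" "v (i + t) = v (j' + t')"
          "e + t' = t \<or> e + t' = t + (d + 2)"
        using shared by blast
      then have "t' = Suc t"
        using 3 t by auto
      then show "v (i + t) = v (Suc j' + t)"
        using t' by simp
    qed
    then show ?thesis
      using j' by simp
  next
    case 4
    then have "e - 1 < d" "e - 1 + 1 = e" "e - 2 < d" "e - 2 + 2 = e"
      by linarith+
    then have "e - 1 = s" "e - 2 = s"
      using bad by blast+
    then show ?thesis
      using 4 by linarith
  qed
qed

section \<open>Consecutive windows and the cycle they form\<close>

lemma window_Suc_neq: "window i \<noteq> window (Suc i)"
proof
  assume "window i = window (Suc i)"
  then have "[i = Suc i] (mod L)"
    using window_eq_imp[of i "Suc i"] by (simp add: cong_def)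
  then have "[i + 0 = i + 1] (mod L)"
    by simp
  then have "[0 = 1] (mod L)"
    by (simp only: cong_add_lcancel_nat)
  then show False
    using L_ge by (simp add: cong_def)
qed

text \<open>Equal sizes and distinctness cap the overlap at \<open>d - 1\<close>; the terms from
  \<open>i + 1\<close> to \<open>i + d - 1\<close> attain it.\<close>

lemma card_window_Int_Suc: "card (window i \<inter> window (Suc i)) = d - 1"
proof (rule antisym)
  have "\<not> window i \<subseteq> window (Suc i)"
    using window_Suc_neq card_subset_eq[OF finite_window] card_window by metis
  then have "window i \<inter> window (Suc i) \<subset> window i"
    by blast
  then have "card (window i \<inter> window (Suc i)) < card (window i)"
    by (rule psubset_card_mono[OF finite_window])
  then show "card (window i \<inter> window (Suc i)) \<le> d - 1"
    using card_window by simp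
next
  have "inj_on (\<lambda>t. v (Suc i + t)) {..<d - 1}"
    using inj_on_window[of "Suc i"] by (rule inj_on_subset) auto
  then have "d - 1 = card ((\<lambda>t. v (Suc i + t)) ` {..<d - 1})"
    by (simp add: card_image)
  also have "\<dots> \<le> card (window i \<inter> window (Suc i))"
  proof (rule card_mono)
    have "v (Suc i + t) \<in> window i" if "t < d - 1" for t
      unfolding window_def using that by (intro image_eqI[of _ _ "Suc t"]) auto
    then show "(\<lambda>t. v (Suc i + t)) ` {..<d - 1} \<subseteq> window i \<inter> window (Suc i)"
      by (auto simp: window_def)
  qed (simp add: finite_window)
  finally show "d - 1 \<le> card (window i \<inter> window (Suc i))" .
qed

lemma dual_edges_windows:
  "dual_edges d (window ` {..<L}) = {{window i, window ((i + 1) mod L)} | i. i < L}" (is "?E = ?E'")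
proof
  show "?E \<subseteq> ?E'"
  proof
    fix x assume "x \<in> ?E"
    then obtain i j where ij: "i < L" "j < L" "x = {window i, window j}"
        "window i \<noteq> window j" "card (window i \<inter> window j) = d - 1"
      by (auto simp: dual_edges_def)
    then have "j = (i + 1) mod L \<or> i = (j + 1) mod L"
      using adjacent_windows_imp[OF ij(4,5)] by auto
    then show "x \<in> ?E'"
      using ij by blast
  qed
next
  show "?E' \<subseteq> ?E"
  proof
    fix x assume "x \<in> ?E'"
    then obtain i where i: "i < L" "x = {window i, window ((i + 1) mod L)}"
      by blast
    have mem: "window i \<in> window ` {..<L}" "window ((i + 1) mod L) \<in> window ` {..<L}"
      using i(1) L_pos by auto
    have "window ((i + 1) mod L) = window (Suc i)"
      using window_mod[of "Suc i"] by simp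
    then have "window i \<noteq> window ((i + 1) mod L)"
        "card (window i \<inter> window ((i + 1) mod L)) = d - 1"
      using window_Suc_neq[of i] card_window_Int_Suc[of i] by auto
    then show "x \<in> ?E"
      using i(2) mem unfolding dual_edges_def by blast
  qed
qed

lemma is_cycle_graph_windows:
  "is_cycle_graph (window ` {..<L}) (dual_edges d (window ` {..<L}))"
proof -
  have "bij_betw window {..<L} (window ` {..<L})"
    using inj_on_windows by (simp add: bij_betw_def)
  moreover have "3 \<le> L"
    using L_ge by simp
  ultimately show ?thesis
    unfolding is_cycle_graph_def dual_edges_windows by blast
qed

lemma card_windows: "card (window ` {..<L}) = L"
  using card_image[OF inj_on_windows] by simp

lemma window_subset_range: "window i \<subseteq> range v"
  by (auto simp: window_def)

end

section \<open>Multiplicative order of a primitive element\<close>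

text \<open>Finiteness of \<open>K\<close> makes the powers of \<open>a\<close> repeat, so
  \<open>a\<close> has a finite order \<open>T\<close>. Reducing integer exponents modulo
  \<open>T\<close> shows that its \<open>T\<close> distinct powers exhaust
  \<open>K - {0}\<close>.\<close>

lemma power_eq_iff_of_primitive:
  fixes a :: "'k::field"
  assumes prim: "primitive_element K a" and fin: "finite K"
  shows "card (K - {0}) > 0"
    and "a ^ i = a ^ j \<longleftrightarrow> [i = j] (mod (card (K - {0})))"
proof -
  let ?R = "range (\<lambda>i::int. a powi i)"
  have R: "K - {0} = ?R"
    using prim by (simp add: primitive_element_def)
  then have finR: "finite ?R"
    using fin by (metis finite_Diff)
  have "a \<noteq> 0"
  proof
    assume "a = 0"
    then have "a powi 1 = 0"
      by simp
    then have "0 \<in> ?R"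
      by (metis rangeI)
    then show False
      using R by blast
  qed
  have "range (\<lambda>i::nat. a ^ i) \<subseteq> ?R"
    by (auto simp flip: power_int_of_nat)
  then have "\<not> inj (\<lambda>i::nat. a ^ i)"
    using finR by (metis finite_imageD finite_subset infinite_UNIV_nat)
  then obtain m n where mn: "m < n" "a ^ m = a ^ n"
    unfolding inj_def by (metis linorder_neqE_nat)
  then have "a ^ (n - m) = 1"
    using \<open>a \<noteq> 0\<close> by (simp add: power_diff)
  then have ex: "\<exists>T>0. a ^ T = 1"
    using mn(1) zero_less_diff by blast
  define T where "T = (LEAST T. T > 0 \<and> a ^ T = 1)"
  have T: "T > 0" "a ^ T = 1"
    using LeastI_ex[OF ex] by (auto simp: T_def)
  have least: "T \<le> t" if "t > 0" "a ^ t = 1" for t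
    using that by (simp add: T_def Least_le)
  have red: "a ^ i = a ^ (i mod T)" for i
  proof -
    have "a ^ i = a ^ (T * (i div T) + i mod T)"
      by simp
    also have "\<dots> = a ^ (i mod T)"
      unfolding power_add power_mult T(2) by simp
    finally show ?thesis .
  qed
  have inj: "inj_on (\<lambda>i. a ^ i) {..<T}"
  proof (rule linorder_inj_onI')
    fix i j assume ij: "i \<in> {..<T}" "j \<in> {..<T}" "i < j"
    show "a ^ i \<noteq> a ^ j"
    proof
      assume "a ^ i = a ^ j"
      then have "a ^ (j - i) = 1"
        using ij \<open>a \<noteq> 0\<close> by (simp add: power_diff)
      then show False
        using least[of "j - i"] ij by auto
    qed
  qed
  have "?R = (\<lambda>i. a ^ i) ` {..<T}"
  proof
    show "?R \<subseteq> (\<lambda>i. a ^ i) ` {..<T}"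
    proof
      fix x assume "x \<in> ?R"
      then obtain i :: int where i: "x = a powi i"
        by blast
      have "a powi i = a powi (int T * (i div int T) + i mod int T)"
        by simp
      also have "\<dots> = a powi (i mod int T)"
        using \<open>a \<noteq> 0\<close> T(2) by (subst power_int_add) (simp_all add: power_int_mult)
      also have "\<dots> = a ^ nat (i mod int T)"
        using T(1) by (simp add: power_int_def)
      finally show "x \<in> (\<lambda>i. a ^ i) ` {..<T}"
        using T(1) i by (intro image_eqI[of _ _ "nat (i mod int T)"]) (auto simp: nat_less_iff)
    qed
    show "(\<lambda>i. a ^ i) ` {..<T} \<subseteq> ?R"
      by (auto simp flip: power_int_of_nat)
  qed
  then have T_eq: "card (K - {0}) = T"
    using card_image[OF inj] R by simp
  show "card (K - {0}) > 0"
    using T_eq T by simp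
  have "a ^ i = a ^ j \<longleftrightarrow> a ^ (i mod T) = a ^ (j mod T)"
    using red by metis
  also have "\<dots> \<longleftrightarrow> i mod T = j mod T"
    using inj T(1) by (auto dest: inj_onD)
  finally show "a ^ i = a ^ j \<longleftrightarrow> [i = j] (mod (card (K - {0})))"
    by (simp add: T_eq cong_def)
qed

section \<open>Linear recurring sequences\<close>

lemma map_poly_to_ac_add:
  "map_poly to_ac (p + q) = map_poly to_ac p + map_poly to_ac (q :: 'a::field Polynomial.poly)"
  by (rule poly_eqI) (simp add: coeff_map_poly)

lemma map_poly_to_ac_diff:
  "map_poly to_ac (p - q) = map_poly to_ac p - map_poly to_ac (q :: 'a::field Polynomial.poly)"
  by (rule poly_eqI) (simp add: coeff_map_poly)

lemma map_poly_to_ac_mult: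
  "map_poly to_ac (p * q) = map_poly to_ac p * map_poly to_ac (q :: 'a::field Polynomial.poly)"
  by (rule poly_eqI) (simp add: coeff_map_poly coeff_mult to_ac_sum)

text \<open>The remainder \<open>r mod p\<close> has the same value at \<open>a\<close> as
  \<open>r\<close>, and if nonzero its degree is below that of \<open>p\<close>, so minimality
  decides.\<close>

lemma minimal_polynomial_dvd_iff:
  fixes p r :: "'a::field Polynomial.poly"
  assumes min: "is_minimal_polynomial a p"
  shows "p dvd r \<longleftrightarrow> poly (map_poly to_ac r) a = 0"
proof -
  have p: "p \<noteq> 0" "poly (map_poly to_ac p) a = 0"
    using min by (auto simp: is_minimal_polynomial_def)
  have "poly (map_poly to_ac r) a = poly (map_poly to_ac (p * (r div p) + r mod p)) a"
    by simp
  also have "\<dots> = poly (map_poly to_ac (r mod p)) a"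
    using p(2) by (simp only: map_poly_to_ac_add map_poly_to_ac_mult poly_add poly_mult) simp
  also have "\<dots> = 0 \<longleftrightarrow> r mod p = 0"
    using min degree_mod_less[OF p(1), of r] by (auto simp: is_minimal_polynomial_def)
  finally show ?thesis
    by (simp add: dvd_eq_mod_eq_0)
qed

text \<open>Translates the order of \<open>a\<close> into the order of \<open>x\<close> modulo
  \<open>p\<close>.\<close>

lemma minimal_polynomial_dvd_monom_diff_iff:
  assumes "is_minimal_polynomial a p"
  shows "p dvd Polynomial.monom 1 i - Polynomial.monom 1 j \<longleftrightarrow> a ^ i = a ^ j"
  using minimal_polynomial_dvd_iff[OF assms]
  by (simp add: map_poly_to_ac_diff map_poly_monom poly_monom)

text \<open>
  The value at \<open>g\<close> of a linear functional on the quotient ring modulo \<open>p\<close>; along the powers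
  of \<open>x\<close> it runs through a sequence with characteristic polynomial \<open>p\<close>.
\<close>

definition top_coeff :: "'a::field Polynomial.poly \<Rightarrow> 'a Polynomial.poly \<Rightarrow> 'a" where
  "top_coeff p g = Polynomial.coeff (g mod p) (Polynomial.degree p - 1)"

lemma top_coeff_add: "top_coeff p (g + h) = top_coeff p g + top_coeff p h"
  by (simp add: top_coeff_def poly_mod_add_left)

lemma top_coeff_diff: "top_coeff p (g - h) = top_coeff p g - top_coeff p h"
  by (simp add: top_coeff_def poly_mod_diff_left)

lemma top_coeff_smult: "top_coeff p (smult c g) = c * top_coeff p g"
  by (simp add: top_coeff_def mod_smult_left)

lemma top_coeff_0: "top_coeff p 0 = 0"
  by (simp add: top_coeff_def)

lemma top_coeff_sum: "top_coeff p (sum f A) = (\<Sum>x\<in>A. top_coeff p (f x))"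
  by (induction A rule: infinite_finite_induct) (simp_all add: top_coeff_0 top_coeff_add)

text \<open>Expands \<open>p * g\<close>, which vanishes modulo \<open>p\<close>, into monomials of
  \<open>p\<close>. A general \<open>g\<close> covers differences of two shifts of the
  sequence.\<close>

lemma top_coeff_recurrence:
  "(\<Sum>t\<le>Polynomial.degree p. Polynomial.coeff p t * top_coeff p (Polynomial.monom 1 t * g)) = 0"
proof -
  have "p * g = (\<Sum>t\<le>Polynomial.degree p. Polynomial.monom (Polynomial.coeff p t) t) * g"
    by (simp add: poly_as_sum_of_monoms)
  also have "\<dots> = (\<Sum>t\<le>Polynomial.degree p.
      smult (Polynomial.coeff p t) (Polynomial.monom 1 t * g))"
    by (simp add: sum_distrib_right smult_monom flip: mult_smult_left)
  finally have "top_coeff p (p * g) =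
      (\<Sum>t\<le>Polynomial.degree p. Polynomial.coeff p t * top_coeff p (Polynomial.monom 1 t * g))"
    by (simp add: top_coeff_sum top_coeff_smult)
  then show ?thesis
    by (simp add: top_coeff_def)
qed

text \<open>Multiplying a nonzero remainder by a suitable power of \<open>x\<close> brings its
  leading coefficient to degree \<open>degree p - 1\<close> without any reduction, where the
  functional detects it.\<close>

lemma dvd_of_top_coeff_zero:
  assumes deg: "Polynomial.degree p > 0"
    and zero: "\<And>t. t < Polynomial.degree p \<Longrightarrow> top_coeff p (Polynomial.monom 1 t * g) = 0"
  shows "p dvd g"
proof (rule ccontr)
  assume "\<not> p dvd g"
  then have h: "g mod p \<noteq> 0"
    by (simp add: dvd_eq_mod_eq_0)
  have p: "p \<noteq> 0"
    using deg by auto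
  let ?h = "g mod p"
  define t where "t = Polynomial.degree p - 1 - Polynomial.degree ?h"
  have dh: "Polynomial.degree ?h < Polynomial.degree p"
    using degree_mod_less[OF p] h by blast
  have sum: "t + Polynomial.degree ?h = Polynomial.degree p - 1"
    using dh by (simp add: t_def)
  have "Polynomial.degree (Polynomial.monom 1 t * ?h) = Polynomial.degree p - 1"
    using h sum by (simp add: degree_mult_eq degree_monom_eq)
  then have "(Polynomial.monom 1 t * ?h) mod p = Polynomial.monom 1 t * ?h"
    using deg by (intro mod_poly_less) simp
  then have "(Polynomial.monom 1 t * g) mod p = Polynomial.monom 1 t * ?h"
    by (metis mod_mult_right_eq)
  then have "top_coeff p (Polynomial.monom 1 t * g) = lead_coeff ?h"
    unfolding top_coeff_def sum[symmetric] by (simp add: coeff_monom_mult)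
  then show False
    using zero[of t] h deg by (simp add: t_def)
qed

section \<open>The complex obtained from a primitive polynomial\<close>

theorem theorem2p3:
  fixes d q n :: nat and p :: "'a::finite_field Polynomial.poly"
  assumes "d \<ge> 1"
    and "primepow q" and "CARD('a) = q"
    and "primitive_polynomial (d - 1) p"
    and "\<forall>i\<le>d - 1. Polynomial.coeff p i \<noteq> 0"
    and "n = (d + 2) * q"
  shows "\<exists>(V :: nat set) C.
           pure_complex d V C \<and> card V = n \<and>
           real (card C) \<ge> real n ^ (d - 1) / real (d + 2) ^ (d - 1) - 1 \<and>
           is_cycle_graph C (dual_edges d C)"
proof -
  define k where "k = d - 1"
  obtain K :: "'a alg_closure set" and a where
    K: "range to_ac \<subseteq> K" "card K = q ^ k" and prim: "primitive_element K a"
    and min: "is_minimal_polynomial a p"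
    using assms(3,4) unfolding primitive_polynomial_def k_def by blast
  have deg: "Polynomial.degree p = k"
    using assms(4) by (simp add: primitive_polynomial_def k_def)
  have "q > 0"
    using assms(3) zero_less_card_finite[where 'a = 'a] by simp
  then have finK: "finite K"
    using K(2) card_gt_0_iff[of K] by simp
  have "to_ac 0 \<in> K" "to_ac 1 \<in> K"
    using K(1) by blast+
  then have "0 \<in> K" "1 \<in> K"
    by simp_all
  \<comment> \<open>For \<open>k = 0\<close> the field would have \<open>q ^ 0 = 1\<close> element,
    yet it contains both 0 and 1.\<close>
  have "k > 0"
  proof (rule ccontr)
    assume "\<not> k > 0"
    then have "card K = 1"
      using K(2) by simp
    then show False
      using \<open>0 \<in> K\<close> \<open>1 \<in> K\<close> by (auto simp: card_1_singleton_iff)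
  qed
  then have d: "d \<ge> 2" "d = Suc k"
    by (simp_all add: k_def)
  \<comment> \<open>The order of \<open>a\<close>, hence a period of the sequence
    \<open>u\<close>.\<close>
  define T where "T = q ^ k - 1"
  have "card (K - {0}) = T"
    using \<open>0 \<in> K\<close> K(2) finK by (simp add: T_def)
  then have "T > 0" and power_eq: "a ^ i = a ^ j \<longleftrightarrow> [i = j] (mod T)" for i j
    using power_eq_iff_of_primitive[OF prim finK] by simp_all
  define u where "u i = top_coeff p (Polynomial.monom 1 i)" for i
  \<comment> \<open>By linearity, comparing the sequence at \<open>i\<close> and \<open>j\<close>
    becomes evaluating the functional on multiples of one polynomial.\<close>
  have top_shift: "top_coeff p (Polynomial.monom 1 t * (Polynomial.monom 1 i - Polynomial.monom 1 j))
      = u (i + t) - u (j + t)" for t i j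
    by (simp add: u_def right_diff_distrib mult_monom top_coeff_diff add.commute)
  have u_periodic: "u i = u j" if "[i = j] (mod T)" for i j
  proof -
    have "p dvd Polynomial.monom 1 i - Polynomial.monom 1 j"
      using that power_eq minimal_polynomial_dvd_monom_diff_iff[OF min] by blast
    then have "top_coeff p (Polynomial.monom 1 i - Polynomial.monom 1 j) = 0"
      by (simp add: top_coeff_def)
    then show ?thesis
      by (simp add: u_def top_coeff_diff)
  qed
  \<comment> \<open>Agreement on \<open>k\<close> terms makes the functional vanish on
    \<open>k\<close> shifts of the difference, so \<open>p\<close> divides it and the order of
    \<open>a\<close> applies.\<close>
  have u_state: "[i = j] (mod T)" if "\<And>t. t < k \<Longrightarrow> u (i + t) = u (j + t)" for i j
  proof -
    have "p dvd Polynomial.monom 1 i - Polynomial.monom 1 j"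
      by (rule dvd_of_top_coeff_zero) (use that \<open>k > 0\<close> in \<open>simp_all add: deg top_shift\<close>)
    then show ?thesis
      using power_eq minimal_polynomial_dvd_monom_diff_iff[OF min] by blast
  qed
  have u_determined: "u (i + s) = u (j + s)"
    if s: "s < d" and eq: "\<And>t. \<lbrakk>t < d; t \<noteq> s\<rbrakk> \<Longrightarrow> u (i + t) = u (j + t)" for i j s
  proof -
    \<comment> \<open>In the recurrence for the difference only the term at \<open>s\<close>
      survives, and its coefficient is nonzero.\<close>
    have "0 = (\<Sum>t\<le>k. Polynomial.coeff p t * (u (i + t) - u (j + t)))"
      using top_coeff_recurrence[of p "Polynomial.monom 1 i - Polynomial.monom 1 j"]
      by (simp only: deg top_shift)
    also have "\<dots> = (\<Sum>t\<in>{s}. Polynomial.coeff p t * (u (i + t) - u (j + t)))"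
      by (rule sum.mono_neutral_right) (use s eq d in auto)
    finally have "Polynomial.coeff p s * (u (i + s) - u (j + s)) = 0"
      by simp
    moreover have "Polynomial.coeff p s \<noteq> 0"
      using assms(5) s by simp
    ultimately show ?thesis
      by simp
  qed
  obtain h :: "'a \<Rightarrow> nat" where h: "bij_betw h UNIV {0..<q}"
    using ex_bij_betw_finite_nat[of "UNIV :: 'a set"] assms(3) by auto
  then have h_inj: "h x = h y \<longleftrightarrow> x = y" and h_less: "h x < q" for x y
    by (auto simp: bij_betw_def dest: injD)
  \<comment> \<open>Packs the pair of field element and colour into one number below
    \<open>n\<close>, with the colour as last digit in base \<open>d + 2\<close>.\<close>
  define v where "v i = h (u i) * (d + 2) + i mod (d + 2)" for i
  have v_eq: "v i = v j \<longleftrightarrow> u i = u j \<and> i mod (d + 2) = j mod (d + 2)" for i j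
  proof
    assume eq: "v i = v j"
    have div: "(c * m + l mod m) div m = c" and mod: "(c * m + l mod m) mod m = l mod m"
      if "m > 0" for c l m :: nat
      using that by simp_all
    have "v i div (d + 2) = h (u i)" for i
      unfolding v_def by (rule div) simp
    moreover have "v i mod (d + 2) = i mod (d + 2)" for i
      unfolding v_def by (rule mod) simp
    ultimately show "u i = u j \<and> i mod (d + 2) = j mod (d + 2)"
      using eq h_inj by metis
  qed (simp add: v_def)
  \<comment> \<open>Sequence and colouring repeat together after the lcm; being a multiple of
    \<open>T\<close>, it yields enough facets.\<close>
  define L where "L = lcm T (d + 2)"
  interpret coloured_sequence d L v
  proof
    show "2 \<le> d"
      by (fact d)
    show "0 < L"
      using \<open>T > 0\<close> by (simp add: L_def lcm_pos_nat)
    show "d + 2 dvd L"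
      by (simp add: L_def)
    show "i mod (d + 2) = j mod (d + 2)" if "v i = v j" for i j
      using that v_eq by blast
    show "v (i + L) = v i" for i
    proof -
      have "[i + L = i + 0] (mod T)" "[i + L = i + 0] (mod (d + 2))"
        unfolding cong_add_lcancel_nat L_def by (simp_all add: cong_0_iff)
      then show ?thesis
        using u_periodic[of "i + L" i] v_eq[of "i + L" i] by (simp add: cong_def)
    qed
    show "v (i + s) = v (j + s)"
      if s: "s < d" and eq: "\<And>t. \<lbrakk>t < d; t \<noteq> s\<rbrakk> \<Longrightarrow> v (i + t) = v (j + t)" for s i j
    proof -
      \<comment> \<open>Any other position, available as \<open>d \<ge> 2\<close>, transfers the
        congruence of colours to position \<open>s\<close>.\<close>
      obtain t where "t < d" "t \<noteq> s"
        using d(1) that[of 0] that[of 1] by (cases "s = 0") auto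
      then have "[i + t = j + t] (mod (d + 2))"
        using eq[of t] v_eq[of "i + t" "j + t"] by (simp add: cong_def)
      then have "[i + s = j + s] (mod (d + 2))"
        by (simp only: cong_add_rcancel_nat)
      moreover have "u (i + s) = u (j + s)"
        using u_determined[OF s] eq v_eq by blast
      ultimately show ?thesis
        using v_eq[of "i + s" "j + s"] by (simp add: cong_def)
    qed
    show "i mod L = j mod L" if eq: "\<And>t. t < d - 1 \<Longrightarrow> v (i + t) = v (j + t)" for i j
    proof -
      have "[i = j] (mod T)"
        by (rule u_state) (use eq v_eq in \<open>simp add: k_def\<close>)
      moreover have "[i = j] (mod (d + 2))"
        using eq[of 0] v_eq[of i j] d by (simp add: cong_def)
      ultimately show ?thesis
        unfolding L_def cong_def[symmetric] by (simp add: cong_cong_lcm_nat)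
    qed
  qed
  have "v i < n" for i
  proof -
    have "v i < (h (u i) + 1) * (d + 2)"
      by (simp add: v_def)
    also have "\<dots> \<le> q * (d + 2)"
      by (rule mult_le_mono1) (use h_less[of "u i"] in simp)
    finally show ?thesis
      by (simp add: assms(6) mult.commute)
  qed
  then have "pure_complex d {..<n} (window ` {..<L})"
    using window_subset_range card_window unfolding pure_complex_def by fastforce
  moreover have "real n ^ (d - 1) / real (d + 2) ^ (d - 1) - 1 \<le> real (card (window ` {..<L}))"
  proof -
    \<comment> \<open>Since \<open>n = (d + 2) * q\<close>, the required bound is exactly
      \<open>T\<close>.\<close>
    have "real n ^ (d - 1) / real (d + 2) ^ (d - 1) - 1 = real q ^ k - 1"
      unfolding assms(6) of_nat_mult power_mult_distrib k_def by simp
    also have "\<dots> = real T"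
      using \<open>q > 0\<close> by (simp add: T_def of_nat_diff)
    also have "T \<le> L"
      using dvd_imp_le[OF _ L_pos, of T] by (simp add: L_def)
    finally show ?thesis
      by (simp add: card_windows)
  qed
  ultimately show ?thesis
    using is_cycle_graph_windows card_lessThan[of n] by blast
qed

end
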